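(* Let $G$ be a connected Eulerian digraph on $n$ vertices. Then the $k^{th}$ power $G^k$ with $k=\lceil \tfrac{1}{2} \sqrt{n}\, \log_2^2 n \rceil$ is Hamiltonian.
   Context: Digraphs are simple (no loops or multiple arcs). A digraph is Eulerian if it contains a closed walk using every arc exactly once; for a connected digraph this is equivalent to every vertex having indegree equal to outdegree. For a digraph $G$ and $k\in\mathbb{N}$, the $k^{th}$ power $G^k$ is the digraph on the vertex set of $G$ with an arc from $u$ to $v$ whenever $G$ contains a directed $uv$-path of length at most $k$. A digraph is Hamiltonian if it contains a directed cycle through all of its vertices. $\log_2^2 n$ means $(\log_2 n)^2$. *)

theory Defs
  imports Complex_Main
begin

text \<open>A finite simple digraph is given by a finite vertex set V and an arc
relation A \<subseteq> V \<times> V without loops.\<close>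

definition simple_digraph :: "'a set \<Rightarrow> ('a \<times> 'a) set \<Rightarrow> bool" where
  "simple_digraph V A \<longleftrightarrow> finite V \<and> A \<subseteq> V \<times> V \<and> (\<forall>v. (v, v) \<notin> A)"

text \<open>Connected = weakly connected (underlying undirected graph connected).\<close>
definition connected_digraph :: "'a set \<Rightarrow> ('a \<times> 'a) set \<Rightarrow> bool" where
  "connected_digraph V A \<longleftrightarrow> V \<noteq> {} \<and> (\<forall>u\<in>V. \<forall>v\<in>V. (u, v) \<in> (A \<union> A\<inverse>)\<^sup>*)"

text \<open>Eulerian: a closed walk using every arc exactly once (list of arcs).\<close>
definition eulerian :: "'a set \<Rightarrow> ('a \<times> 'a) set \<Rightarrow> bool" where
  "eulerian V A \<longleftrightarrow> (\<exists>es. distinct es \<and> set es = A \<and>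
      (\<forall>i. Suc i < length es \<longrightarrow> snd (es ! i) = fst (es ! Suc i)) \<and>
      (es \<noteq> [] \<longrightarrow> snd (last es) = fst (hd es)))"

text \<open>A directed path of length m (m arcs) from u to v: distinct vertices
x_0 = u, ..., x_m = v with consecutive arcs.\<close>
definition dpath :: "('a \<times> 'a) set \<Rightarrow> 'a list \<Rightarrow> bool" where
  "dpath A xs \<longleftrightarrow> xs \<noteq> [] \<and> distinct xs \<and>
      (\<forall>i. Suc i < length xs \<longrightarrow> (xs ! i, xs ! Suc i) \<in> A)"

text \<open>k-th power: arc u\<rightarrow>v iff there is a directed u-v path of length at most k
(length \<ge> 1 since the power is again simple, i.e. u \<noteq> v).\<close>
definition digraph_power :: "('a \<times> 'a) set \<Rightarrow> nat \<Rightarrow> ('a \<times> 'a) set" where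
  "digraph_power A k = {(u, v). u \<noteq> v \<and> (\<exists>xs. dpath A xs \<and> hd xs = u \<and> last xs = v
                                    \<and> length xs - 1 \<le> k)}"

text \<open>Hamiltonian: a directed cycle through all vertices.\<close>
definition hamiltonian :: "'a set \<Rightarrow> ('a \<times> 'a) set \<Rightarrow> bool" where
  "hamiltonian V A \<longleftrightarrow> (\<exists>xs. length xs \<ge> 2 \<and> distinct xs \<and> set xs = V \<and>
      (\<forall>i. Suc i < length xs \<longrightarrow> (xs ! i, xs ! Suc i) \<in> A) \<and> (last xs, hd xs) \<in> A)"

end

theory Submission
  imports Defs "HOL-Library.Disjoint_Sets" "Graph_Theory.Euler"
begin

text \<open>Pass to a minimal connected balanced spanning subdigraph and follow an Euler tour of it,
cut into windows of length L of order \<open>\<surd>n\<close>. If the windows have distinct representatives, picking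
one occurrence of every vertex, the representatives within their windows, and reading the picked
occurrences in tour order gives a Hamiltonian cycle with steps of length at most 3 L.

For Hall's condition, suppose j windows meet only t < j vertices. By minimality, arc-disjoint
balanced arc sets on these vertices number at most t, so removing all cycles of length
\<open>O(\<surd>n)\<close> costs \<open>O(t \<surd>n)\<close> arcs. The remaining arcs have large girth, hence can be ordered with only
\<open>O(t\<^sup>2 / n)\<close> backward arcs. In that order the j trails have total drift at most j t, which
leaves room for only \<open>O(j \<surd>n)\<close> forward arcs, fewer than the j L arcs present. The argument needs only
\<open>k \<ge> C \<surd>n\<close>; for small n the exponent exceeds the diameter.\<close>

section \<open>Backward arcs in digraphs of large girth\<close>

fun out_ball :: "('a \<times> 'a) set \<Rightarrow> 'a \<Rightarrow> nat \<Rightarrow> 'a set" where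
  "out_ball E v 0 = {v}"
| "out_ball E v (Suc i) = out_ball E v i \<union> E `` out_ball E v i"

lemma out_ball_relpow: "w \<in> out_ball E v i \<Longrightarrow> \<exists>l\<le>i. (v, w) \<in> E ^^ l"
proof (induction i arbitrary: w)
  case (Suc i)
  show ?case
  proof (cases "w \<in> out_ball E v i")
    case True
    then show ?thesis using Suc.IH le_SucI by blast
  next
    case False
    then obtain u where u: "u \<in> out_ball E v i" "(u, w) \<in> E" using Suc.prems by auto
    then obtain l where "l \<le> i" "(v, u) \<in> E ^^ l" using Suc.IH by blast
    then have "(v, w) \<in> E ^^ Suc l" using u by auto
    then show ?thesis using \<open>l \<le> i\<close> by (intro exI[of _ "Suc l"]) auto
  qed
qed auto

lemma relpow_mono: "R \<subseteq> S \<Longrightarrow> R ^^ l \<subseteq> S ^^ l" for R S :: "('a \<times> 'a) set"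
  by (induction l) auto

lemma converse_relpow_eq: "(E\<inverse>) ^^ m = (E ^^ m)\<inverse>" for E :: "('a \<times> 'a) set"
proof (induction m)
  case (Suc m)
  have "(E\<inverse>) ^^ Suc m = (E O E ^^ m)\<inverse>" by (simp add: Suc converse_relcomp)
  then show ?case by (simp only: relpow_commute[of E m] relpow.simps)
qed simp

lemma out_ball_subset: "v \<in> W \<Longrightarrow> E \<subseteq> W \<times> W \<Longrightarrow> out_ball E v i \<subseteq> W"
  by (induction i) auto

lemma out_ball_mono: "i \<le> j \<Longrightarrow> out_ball E v i \<subseteq> out_ball E v j"
  by (induction j) (auto simp: le_Suc_eq)

lemma center_in_out_ball: "v \<in> out_ball E v i"
  by (induction i) auto

text \<open>If every cut below radius r were expensive, the product of consecutive layer sizes would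
force the ball sizes b to satisfy \<open>b i \<ge> t i\<^sup>2 / r\<^sup>2\<close>.\<close>
lemma out_ball_cheap_cut:
  fixes W :: "'a set"
  assumes fin: "finite W" and v: "v \<in> W" and E: "E \<subseteq> W \<times> W"
    and r: "0 < r" and small: "card (out_ball E v r) < t"
  shows "\<exists>i<r. card (E \<inter> out_ball E v i \<times> (W - out_ball E v i)) * r\<^sup>2 \<le> 4 * t * card (out_ball E v i)"
proof (rule ccontr)
  let ?B = "out_ball E v"
  let ?c = "\<lambda>i. card (E \<inter> ?B i \<times> (W - ?B i))"
  assume "\<not> ?thesis"
  then have big: "4 * t * card (?B i) < ?c i * r\<^sup>2" if "i < r" for i
    using that by (auto simp: not_le)
  have finB: "finite (?B i)" for i
    using out_ball_subset[OF v E] fin finite_subset by blast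
  have mono: "card (?B i) \<le> card (?B (Suc i))" for i
    by (rule card_mono[OF finB]) (rule out_ball_mono, simp)
  \<comment> \<open>Arcs that start within radius i end within radius \<open>Suc i\<close>, so an
    arc leaving the larger ball joins its outermost layer to the next layer.\<close>
  have cut: "?c (Suc i) \<le> (card (?B (Suc i)) - card (?B i)) * (card (?B (Suc (Suc i))) - card (?B (Suc i)))" for i
  proof -
    have "E \<inter> ?B (Suc i) \<times> (W - ?B (Suc i)) \<subseteq> (?B (Suc i) - ?B i) \<times> (?B (Suc (Suc i)) - ?B (Suc i))"
      by auto
    then have "?c (Suc i) \<le> card ((?B (Suc i) - ?B i) \<times> (?B (Suc (Suc i)) - ?B (Suc i)))"
      by (rule card_mono[rotated]) (use finB in blast)
    moreover have "card (?B (Suc j) - ?B j) = card (?B (Suc j)) - card (?B j)" for j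
      by (rule card_Diff_subset[OF finB]) (rule out_ball_mono, simp)
    ultimately show ?thesis by (simp only: card_cartesian_product)
  qed
  have cut0: "?c 0 \<le> card (?B 1)"
  proof -
    have "E \<inter> ?B 0 \<times> (W - ?B 0) \<subseteq> {v} \<times> ?B 1" by auto
    then have "?c 0 \<le> card ({v} \<times> ?B 1)"
      by (rule card_mono[rotated]) (use finB in blast)
    then show ?thesis by (simp only: card_cartesian_product_singleton)
  qed
  \<comment> \<open>Two consecutive radii are carried through the induction, because the bound for
    \<open>Suc (Suc i)\<close> uses both preceding balls.\<close>
  have growth: "t * i\<^sup>2 \<le> card (?B i) * r\<^sup>2 \<and> (i < r \<longrightarrow> t * (Suc i)\<^sup>2 \<le> card (?B (Suc i)) * r\<^sup>2)" if "i \<le> r" for i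
    using that
  proof (induction i)
    case 0
    have "t \<le> card (?B 1) * r\<^sup>2" if "0 < r"
    proof -
      have "4 * t \<le> ?c 0 * r\<^sup>2" using big[OF that] by simp
      also have "\<dots> \<le> card (?B 1) * r\<^sup>2" using cut0 by simp
      finally show ?thesis by simp
    qed
    then show ?case by simp
  next
    case (Suc i)
    have lo: "t * i\<^sup>2 \<le> card (?B i) * r\<^sup>2" and hi: "t * (Suc i)\<^sup>2 \<le> card (?B (Suc i)) * r\<^sup>2"
      using Suc by auto
    have "t * (Suc (Suc i))\<^sup>2 \<le> card (?B (Suc (Suc i))) * r\<^sup>2" if "Suc i < r"
    proof -
      define x where "x = card (?B (Suc i)) - card (?B i)"
      define y where "y = card (?B (Suc (Suc i))) - card (?B (Suc i))"
      have xy: "card (?B (Suc (Suc i))) = card (?B i) + (x + y)"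
        using mono[of i] mono[of "Suc i"] by (simp add: x_def y_def)
      have "4 * t * card (?B (Suc i)) \<le> (x * y) * r\<^sup>2"
        using big[OF that] mult_right_mono[OF cut[of i], of "r\<^sup>2"] unfolding x_def y_def by linarith
      then have 1: "(4 * t * card (?B (Suc i))) * r\<^sup>2 \<le> ((x * y) * r\<^sup>2) * r\<^sup>2"
        by (rule mult_right_mono) simp
      have 2: "4 * t * (t * (Suc i)\<^sup>2) \<le> 4 * t * (card (?B (Suc i)) * r\<^sup>2)"
        by (rule mult_left_mono[OF hi]) simp
      have amgm: "4 * (x * y) \<le> (x + y)\<^sup>2"
      proof -
        have "4 * (int x * int y) \<le> (int x + int y)\<^sup>2"
          using zero_le_power2[of "int x - int y"] by (simp add: power2_eq_square algebra_simps)
        then show ?thesis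
          by (metis (mono_tags, lifting) of_nat_add of_nat_le_iff of_nat_mult of_nat_numeral of_nat_power)
      qed
      have 3: "4 * (((x * y) * r\<^sup>2) * r\<^sup>2) \<le> ((x + y) * r\<^sup>2)\<^sup>2"
        using mult_right_mono[OF amgm, of "r\<^sup>2 * r\<^sup>2"] by (simp add: power_mult_distrib power2_eq_square algebra_simps)
      \<comment> \<open>The 4 of the assumed cut bound and the 4 of \<open>amgm\<close> multiply to
        a square, and its root gives exactly the increment t ((i + 2)^2 - i^2) = 4 t (i +
        1).\<close>
      have "(4 * t * Suc i)\<^sup>2 = 4 * (4 * t * (t * (Suc i)\<^sup>2))"
        by (simp add: power2_eq_square algebra_simps)
      also have "\<dots> \<le> 4 * (4 * t * (card (?B (Suc i)) * r\<^sup>2))" using 2 by linarith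
      also have "\<dots> = 4 * ((4 * t * card (?B (Suc i))) * r\<^sup>2)" by (simp add: algebra_simps)
      also have "\<dots> \<le> ((x + y) * r\<^sup>2)\<^sup>2" using 1 3 by linarith
      finally have "4 * t * Suc i \<le> (x + y) * r\<^sup>2"
        by (rule power2_le_imp_le) simp
      then have "t * i\<^sup>2 + 4 * t * Suc i \<le> (card (?B i) + (x + y)) * r\<^sup>2"
        using lo by (simp only: distrib_right)
      then show ?thesis unfolding xy by (simp add: power2_eq_square algebra_simps)
    qed
    then show ?case using hi by blast
  qed
  show False using growth[of r] r small by simp
qed

lemma card_add_le_of_almost_disjoint:
  "finite W \<Longrightarrow> X \<subseteq> W \<Longrightarrow> Y \<subseteq> W \<Longrightarrow> X \<inter> Y \<subseteq> {v} \<Longrightarrow> card X + card Y \<le> card W + 1"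
  using card_Un_Int[of X Y] card_mono[of W "X \<union> Y"] card_mono[of "{v}" "X \<inter> Y"]
  by (auto simp: finite_subset)

text \<open>The cheap cut is taken with t = \<open>card W\<close>. Since the ball fills at most
  about half of W, the factor \<open>card W\<close> can be traded for the size of the complement.
  The resulting product is symmetric in the two sides and adds up well in a recursive
  bisection.\<close>

lemma small_out_ball_sparse_cut:
  fixes W :: "'a set"
  assumes fin: "finite W" and v: "v \<in> W" and E: "E \<subseteq> W \<times> W" and W2: "2 \<le> card W" and r: "0 < r"
    and half: "2 * card (out_ball E v r) \<le> card W + 1"
  shows "\<exists>X. X \<noteq> {} \<and> X \<subset> W \<and> card (E \<inter> X \<times> (W - X)) * r\<^sup>2 \<le> 12 * card X * card (W - X)"
proof -
  let ?B = "out_ball E v" and ?t = "card W"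
  have "card (?B r) < ?t" using half W2 by linarith
  from out_ball_cheap_cut[OF fin v E r this] obtain i where i: "i < r"
    and cut: "card (E \<inter> ?B i \<times> (W - ?B i)) * r\<^sup>2 \<le> 4 * ?t * card (?B i)" by blast
  have sub: "?B i \<subseteq> W" and finB: "finite (?B r)"
    using out_ball_subset[OF v E] fin finite_subset by blast+
  have le: "card (?B i) \<le> card (?B r)" using i by (intro card_mono[OF finB] out_ball_mono) simp
  have compl: "card (W - ?B i) = ?t - card (?B i)"
    using sub fin by (simp add: card_Diff_subset finite_subset)
  \<comment> \<open>The extreme case is \<open>card W = 3\<close> with a ball of two
    vertices.\<close>
  have "?t \<le> 3 * card (W - ?B i)" using le half W2 unfolding compl by linarith
  then have "4 * ?t * card (?B i) \<le> 4 * (3 * card (W - ?B i)) * card (?B i)" by simp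
  also have "\<dots> = 12 * card (?B i) * card (W - ?B i)" by (simp add: algebra_simps)
  finally have "card (E \<inter> ?B i \<times> (W - ?B i)) * r\<^sup>2 \<le> 12 * card (?B i) * card (W - ?B i)"
    using cut by linarith
  moreover have "?B i \<noteq> W" using le half W2 by auto
  ultimately show ?thesis using sub center_in_out_ball[of v E i] by blast
qed

text \<open>By the girth, the out-ball and the in-ball around v meet only in v, so one of them contains at
most about half of W.\<close>
lemma sparse_cut:
  fixes W :: "'a set"
  assumes fin: "finite W" and E: "E \<subseteq> W \<times> W" and W2: "2 \<le> card W" and r: "0 < r"
    and girth: "\<And>v l. 0 < l \<Longrightarrow> l \<le> 2 * r \<Longrightarrow> (v, v) \<notin> E ^^ l"
  shows "\<exists>X. X \<noteq> {} \<and> X \<subset> W \<and> card (E \<inter> X \<times> (W - X)) * r\<^sup>2 \<le> 12 * card X * card (W - X)"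
proof -
  obtain v where v: "v \<in> W" using W2 by fastforce
  have E': "E\<inverse> \<subseteq> W \<times> W" using E by blast
  have "out_ball E v r \<inter> out_ball (E\<inverse>) v r \<subseteq> {v}"
  proof
    fix w assume "w \<in> out_ball E v r \<inter> out_ball (E\<inverse>) v r"
    then obtain l m where l: "l \<le> r" "(v, w) \<in> E ^^ l" and m: "m \<le> r" "(v, w) \<in> (E\<inverse>) ^^ m"
      using out_ball_relpow by (metis IntE)
    then have "(v, v) \<in> E ^^ (l + m)" by (auto simp: relpow_add converse_relpow_eq)
    then have "l + m = 0" using girth[of "l + m" v] l m by (cases "l + m = 0") auto
    then show "w \<in> {v}" using l by simp
  qed
  from card_add_le_of_almost_disjoint[OF fin out_ball_subset[OF v E] out_ball_subset[OF v E'] this]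
  consider "2 * card (out_ball E v r) \<le> card W + 1" | "2 * card (out_ball (E\<inverse>) v r) \<le> card W + 1"
    by linarith
  then show ?thesis
  proof cases
    case 1
    then show ?thesis by (rule small_out_ball_sparse_cut[OF fin v E W2 r])
  next
    case 2
    from small_out_ball_sparse_cut[OF fin v E' W2 r 2] obtain X where X: "X \<noteq> {}" "X \<subset> W"
      "card (E\<inverse> \<inter> X \<times> (W - X)) * r\<^sup>2 \<le> 12 * card X * card (W - X)" by blast
    \<comment> \<open>A cut leaving X in the reversed digraph is a cut of E leaving
      \<open>W - X\<close>.\<close>
    have "E\<inverse> \<inter> X \<times> (W - X) = (E \<inter> (W - X) \<times> X)\<inverse>" by blast
    then have "card (E\<inverse> \<inter> X \<times> (W - X)) = card (E \<inter> (W - X) \<times> X)" by (simp add: card_inverse)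
    moreover have "W - (W - X) = X" using X by blast
    ultimately show ?thesis using X by (intro exI[of _ "W - X"]) (auto simp: algebra_simps)
  qed
qed

text \<open>Split W along a sparse cut and order both sides recursively. Only the arcs of the cut
  become backward in addition, and the product form of the cut bound closes the induction through 6
  a^2 + 6 b^2 + 12 a b = 6 (a + b)^2.\<close>

lemma feedback_arc_bound:
  fixes W :: "'a set"
  assumes "finite W"
    and "\<And>v l. 0 < l \<Longrightarrow> l \<le> 2 * r \<Longrightarrow> (v, v) \<notin> E ^^ l" and "0 < r"
  shows "\<exists>pos. bij_betw pos W {..<card W} \<and>
    card {(u, v) \<in> E \<inter> W \<times> W. pos v \<le> (pos u :: nat)} * r\<^sup>2 \<le> 6 * (card W)\<^sup>2"
  using assms
proof (induction "card W" arbitrary: W rule: less_induct)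
  case less
  note fin = less.prems(1) and girth = less.prems(2)
  have irr: "(x, x) \<notin> E" for x using girth[of 1 x] less.prems(3) by simp
  show ?case
  proof (cases "2 \<le> card W")
    case False
    obtain pos where pos: "bij_betw pos W {..<card W}"
      using ex_bij_betw_finite_nat[OF fin] by (auto simp: atLeast0LessThan)
    have "card W = 0 \<or> card W = 1" using False by linarith
    then have "W = {} \<or> (\<exists>x. W = {x})" using fin by (auto simp: card_1_singleton_iff)
    then have "{(u, v) \<in> E \<inter> W \<times> W. pos v \<le> pos u} = {}" using irr by auto
    then have "card {(u, v) \<in> E \<inter> W \<times> W. pos v \<le> pos u} = 0" by (simp only: card.empty)
    then show ?thesis using pos by (intro exI[of _ pos]) simp
  next
    case True
    have girth': "(v, v) \<notin> (E \<inter> W \<times> W) ^^ l" if "0 < l" "l \<le> 2 * r" for v l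
      using girth[OF that, of v] relpow_mono[of "E \<inter> W \<times> W" E l] by blast
    obtain X where X: "X \<noteq> {}" "X \<subset> W"
      and cut: "card ((E \<inter> W \<times> W) \<inter> X \<times> (W - X)) * r\<^sup>2 \<le> 12 * card X * card (W - X)"
      using sparse_cut[OF fin Int_lower2 True less.prems(3) girth'] by metis
    define Y where "Y = W - X"
    have Y: "Y \<subset> W" "X \<inter> Y = {}" "X \<union> Y = W" using X by (auto simp: Y_def)
    have finXY: "finite X" "finite Y" using X Y fin by (auto intro: finite_subset)
    have cW: "card W = card X + card Y" using Y finXY card_Un_disjoint by metis
    obtain p where p: "bij_betw p X {..<card X}"
      "card {(u, v) \<in> E \<inter> X \<times> X. p v \<le> p u} * r\<^sup>2 \<le> 6 * (card X)\<^sup>2"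
      using less.hyps[OF psubset_card_mono[OF fin X(2)] finXY(1) girth less.prems(3)] by blast
    obtain q where q: "bij_betw q Y {..<card Y}"
      "card {(u, v) \<in> E \<inter> Y \<times> Y. q v \<le> q u} * r\<^sup>2 \<le> 6 * (card Y)\<^sup>2"
      using less.hyps[OF psubset_card_mono[OF fin Y(1)] finXY(2) girth less.prems(3)] by blast
    \<comment> \<open>Y is placed before X, so arcs from Y to X go forward and those from X to Y are
      the ones the cut counts.\<close>
    define pos where "pos x = (if x \<in> X then card Y + p x else q x)" for x
    have "bij_betw pos (X \<union> Y) ({card Y..<card Y + card X} \<union> {..<card Y})"
    proof (rule bij_betw_combine)
      have "bij_betw ((+) (card Y) \<circ> p) X {card Y..<card Y + card X}"
        by (rule bij_betw_trans[OF p(1)])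
           (use image_add_atLeastLessThan[of "card Y" 0 "card X"] in
             \<open>simp add: bij_betw_def lessThan_atLeast0 add.commute\<close>)
      then show "bij_betw pos X {card Y..<card Y + card X}"
        by (subst bij_betw_cong[of _ _ "(+) (card Y) \<circ> p"]) (auto simp: pos_def)
      show "bij_betw pos Y {..<card Y}"
        using q(1) Y by (subst bij_betw_cong[of _ _ q]) (auto simp: pos_def)
    qed auto
    moreover have "{card Y..<card Y + card X} \<union> {..<card Y} = {..<card W}" using cW by auto
    ultimately have bij: "bij_betw pos W {..<card W}" using Y by simp
    let ?bX = "{(u, v) \<in> E \<inter> X \<times> X. p v \<le> p u}" and ?bY = "{(u, v) \<in> E \<inter> Y \<times> Y. q v \<le> q u}"
    let ?c = "(E \<inter> W \<times> W) \<inter> X \<times> Y"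
    have qlt: "q y < card Y" if "y \<in> Y" for y using q(1) that by (auto simp: bij_betw_def)
    have "{(u, v) \<in> E \<inter> W \<times> W. pos v \<le> pos u} \<subseteq> ?bX \<union> ?bY \<union> ?c"
      using Y qlt by (fastforce simp: pos_def split: if_splits)
    moreover have "finite (?bX \<union> ?bY \<union> ?c)"
      by (rule finite_subset[of _ "W \<times> W"]) (use Y fin in auto)
    ultimately have "card {(u, v) \<in> E \<inter> W \<times> W. pos v \<le> pos u} \<le> card (?bX \<union> ?bY \<union> ?c)"
      by (rule card_mono[rotated])
    also have "\<dots> \<le> card ?bX + card ?bY + card ?c"
      by (meson add_mono card_Un_le le_refl order_trans)
    finally have "card {(u, v) \<in> E \<inter> W \<times> W. pos v \<le> pos u} * r\<^sup>2
        \<le> card ?bX * r\<^sup>2 + card ?bY * r\<^sup>2 + card ?c * r\<^sup>2"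
      by (simp only: distrib_right[symmetric]) (rule mult_le_mono1)
    also have "\<dots> \<le> 6 * (card X)\<^sup>2 + 6 * (card Y)\<^sup>2 + 12 * card X * card Y"
      using p(2) q(2) cut unfolding Y_def by linarith
    also have "\<dots> = 6 * (card W)\<^sup>2" unfolding cW by (simp add: power2_eq_square algebra_simps)
    finally show ?thesis using bij by blast
  qed
qed

section \<open>Packing balanced arc sets\<close>

text \<open>Equal in- and outdegrees, tested against all weights h: this form is additive over disjoint
unions and also yields the drift of a trail.\<close>
definition balanced :: "('a \<times> 'a) set \<Rightarrow> bool" where
  "balanced Z \<longleftrightarrow> (\<forall>h :: 'a \<Rightarrow> int. (\<Sum>e\<in>Z. h (snd e) - h (fst e)) = 0)"

lemma balanced_diff:
  assumes "finite A" "Z \<subseteq> A" "balanced A" "balanced Z"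
  shows "balanced (A - Z)"
  unfolding balanced_def
proof
  fix h :: "'a \<Rightarrow> int"
  show "(\<Sum>e\<in>A - Z. h (snd e) - h (fst e)) = 0"
    using assms(3,4) unfolding sum_diff[OF assms(1,2)] balanced_def by (metis diff_self)
qed

lemma balanced_degrees:
  assumes "finite A" "balanced A"
  shows "card {e \<in> A. snd e = v} = card {e \<in> A. fst e = v}"
proof -
  \<comment> \<open>Tested against the indicator of v, balance compares the arcs entering v with
    those leaving it.\<close>
  let ?h = "\<lambda>x. if x = v then 1 else 0 :: int"
  have "(\<Sum>e\<in>A. ?h (snd e)) = (\<Sum>e\<in>A. ?h (fst e))"
    using spec[OF assms(2)[unfolded balanced_def], of ?h] by (simp only: sum_subtractf right_minus_eq)
  then show ?thesis using assms(1) by (simp add: sum.If_cases Int_def)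
qed

lemma balanced_closed_walk:
  fixes w :: "nat \<Rightarrow> 'a"
  assumes "inj_on (\<lambda>i. (w i, w (Suc i))) {..<m}" "w m = w 0"
  shows "balanced ((\<lambda>i. (w i, w (Suc i))) ` {..<m})"
  unfolding balanced_def
proof
  fix h :: "'a \<Rightarrow> int"
  show "(\<Sum>e\<in>(\<lambda>i. (w i, w (Suc i))) ` {..<m}. h (snd e) - h (fst e)) = 0"
    using assms sum_lessThan_telescope[of "\<lambda>i. h (w i)" m] by (simp add: sum.reindex)
qed

text \<open>A shortest closed walk of positive length, over all base points, is a cycle: a repeated
  vertex would split off a shorter one. Hence it repeats no arc and its arc set is balanced.\<close>

lemma closed_walk_contains_balanced:
  assumes "(v, v) \<in> E ^^ l" "0 < l" "l \<le> g"
  shows "\<exists>Z\<subseteq>E. Z \<noteq> {} \<and> card Z \<le> g \<and> finite Z \<and> balanced Z"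
proof -
  let ?P = "\<lambda>l. 0 < l \<and> (\<exists>v. (v, v) \<in> E ^^ l)"
  define m where "m = (LEAST l. ?P l)"
  have m: "?P m" unfolding m_def by (rule LeastI[of ?P l]) (use assms in blast)
  have min: "m \<le> l'" if "?P l'" for l' unfolding m_def by (rule Least_le) (rule that)
  have "m \<le> l" using min assms by blast
  from m obtain v w where w: "w 0 = v" "w m = v" and arc: "\<And>i. i < m \<Longrightarrow> (w i, w (Suc i)) \<in> E"
    by (auto simp: relpow_fun_conv)
  have "inj_on w {..<m}"
  proof (rule linorder_inj_onI)
    fix i j assume ij: "i < j" "i \<in> {..<m}" "j \<in> {..<m}"
    show "w i \<noteq> w j"
    proof
      assume eq: "w i = w j"
      have "(w i, w j) \<in> E ^^ (j - i)"
        unfolding relpow_fun_conv using arc ij by (intro exI[of _ "\<lambda>k. w (i + k)"]) auto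
      then have "?P (j - i)" using ij eq by auto
      then show False using min[of "j - i"] ij by auto
    qed
  qed auto
  then have inj: "inj_on (\<lambda>i. (w i, w (Suc i))) {..<m}" by (auto simp: inj_on_def)
  let ?Z = "(\<lambda>i. (w i, w (Suc i))) ` {..<m}"
  have "balanced ?Z" by (rule balanced_closed_walk[OF inj]) (simp add: w)
  moreover have "card ?Z \<le> g" using card_image_le[of "{..<m}" "\<lambda>i. (w i, w (Suc i))"] \<open>m \<le> l\<close> assms by simp
  moreover have "?Z \<noteq> {}" "?Z \<subseteq> E" using m arc by auto
  ultimately show ?thesis by (intro exI[of _ ?Z]) auto
qed

section \<open>Weak components and the size of packings\<close>

definition weak_conn :: "('a \<times> 'a) set \<Rightarrow> ('a \<times> 'a) set" where
  "weak_conn F = (F \<union> F\<inverse>)\<^sup>*"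

lemma weak_conn_mono: "F \<subseteq> F' \<Longrightarrow> weak_conn F \<subseteq> weak_conn F'"
  unfolding weak_conn_def by (intro rtrancl_mono) auto

lemma weak_conn_equiv: "equiv UNIV (weak_conn F)"
  unfolding weak_conn_def
  by (intro equivI refl_rtrancl sym_rtrancl trans_rtrancl sym_Un_converse) auto

lemma weak_conn_class_eq: "weak_conn F `` {x} = weak_conn F `` {y} \<longleftrightarrow> (x, y) \<in> weak_conn F"
  by (rule eq_equiv_class_iff[OF weak_conn_equiv UNIV_I UNIV_I])

text \<open>Sending an F-class to the F'-class that contains it maps classes onto classes. It is not
  injective, since the distinct classes of u and v get merged.\<close>

lemma card_weak_components_less:
  assumes fin: "finite T" and uv: "u \<in> T" "v \<in> T" and F: "F \<subseteq> F'"
    and "(u, v) \<notin> weak_conn F" "(u, v) \<in> weak_conn F'"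
  shows "card ((\<lambda>x. weak_conn F' `` {x}) ` T) < card ((\<lambda>x. weak_conn F `` {x}) ` T)"
proof -
  let ?c = "\<lambda>x. weak_conn F `` {x}" and ?c' = "\<lambda>x. weak_conn F' `` {x}"
  let ?f = "\<lambda>X. weak_conn F' `` X"
  have f: "?f (?c x) = ?c' x" for x
  proof -
    have "(x, x) \<in> weak_conn F" by (simp add: weak_conn_def)
    moreover have "trans (weak_conn F')" by (simp add: weak_conn_def trans_rtrancl)
    ultimately show ?thesis using weak_conn_mono[OF F] by (auto elim: transE)
  qed
  then have im: "?c' ` T = ?f ` (?c ` T)" by (auto simp: image_image)
  have "\<not> inj_on ?f (?c ` T)"
  proof
    assume "inj_on ?f (?c ` T)"
    moreover have "?f (?c u) = ?f (?c v)" using assms(6) by (simp only: f weak_conn_class_eq)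
    ultimately have "?c u = ?c v" using uv by (meson imageI inj_onD)
    then show False using assms(5) by (simp only: weak_conn_class_eq)
  qed
  then have "card (?f ` (?c ` T)) \<noteq> card (?c ` T)" using fin eq_card_imp_inj_on by blast
  then show ?thesis unfolding im using card_image_le[of "?c ` T" ?f] fin by simp
qed

text \<open>Add the members one at a time, starting from singleton components. Each new Z has an arc
  whose ends are not weakly connected even by all other members together, so it lowers the number of
  components meeting T, which is at most \<open>card T\<close> at the start.\<close>

lemma card_irredundant_family:
  assumes "finite \<Z>" "finite T" "\<And>Z. Z \<in> \<Z> \<Longrightarrow> Z \<subseteq> T \<times> T"
    and "\<And>Z. Z \<in> \<Z> \<Longrightarrow> \<not> Z \<subseteq> weak_conn (\<Union>(\<Z> - {Z}))"
  shows "card \<Z> \<le> card T"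
proof -
  have "\<lbrakk>finite \<F>; \<F> \<subseteq> \<Z>\<rbrakk> \<Longrightarrow> card \<F> + card ((\<lambda>x. weak_conn (\<Union>\<F>) `` {x}) ` T) \<le> card T" for \<F>
  proof (induction \<F> rule: finite_induct)
    case empty
    then show ?case using assms(2) by (simp add: card_image_le)
  next
    case (insert Z \<F>)
    then have Z: "Z \<in> \<Z>" and "\<Union>\<F> \<subseteq> \<Union>(\<Z> - {Z})" by auto
    then have "\<not> Z \<subseteq> weak_conn (\<Union>\<F>)" using assms(4)[OF Z] weak_conn_mono by blast
    then obtain u v where uv: "(u, v) \<in> Z" "(u, v) \<notin> weak_conn (\<Union>\<F>)" by auto
    have "card ((\<lambda>x. weak_conn (\<Union>(insert Z \<F>)) `` {x}) ` T) < card ((\<lambda>x. weak_conn (\<Union>\<F>) `` {x}) ` T)"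
      using uv assms(3)[OF Z]
      by (intro card_weak_components_less[OF assms(2), of u v]) (auto simp: weak_conn_def)
    then show ?case using insert by simp
  qed
  from this[OF assms(1) order_refl] show ?thesis by simp
qed

lemma connected_digraph_remove:
  assumes "connected_digraph V A" "Z \<subseteq> weak_conn (A - Z)"
  shows "connected_digraph V (A - Z)"
proof -
  have sym: "sym (weak_conn (A - Z))" using weak_conn_equiv equiv_def by blast
  have "A \<union> A\<inverse> \<subseteq> weak_conn (A - Z)"
  proof -
    have "A - Z \<subseteq> weak_conn (A - Z)" by (auto simp: weak_conn_def)
    then have "A \<subseteq> weak_conn (A - Z)" using assms(2) by blast
    then show ?thesis using sym by (auto elim: symE)
  qed
  then have "(A \<union> A\<inverse>)\<^sup>* \<subseteq> weak_conn (A - Z)"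
    unfolding weak_conn_def by (metis rtrancl_mono rtrancl_idemp)
  then show ?thesis using assms(1) by (auto simp: connected_digraph_def weak_conn_def)
qed

text \<open>Minimality makes the family irredundant: if the other members, which avoid Z, already
  connected the ends of every arc of Z, then \<open>A - Z\<close> would be a smaller connected
  balanced arc set.\<close>

lemma minimal_balanced_packing:
  assumes fin: "finite A" and con: "connected_digraph V A" and bal: "balanced A"
    and min: "\<And>B. B \<subset> A \<Longrightarrow> balanced B \<Longrightarrow> \<not> connected_digraph V B"
    and T: "finite T" and disj: "disjoint \<Z>"
    and Z: "\<And>Z. Z \<in> \<Z> \<Longrightarrow> Z \<noteq> {} \<and> Z \<subseteq> A \<inter> T \<times> T \<and> balanced Z"
  shows "card \<Z> \<le> card T"
proof (rule card_irredundant_family[OF _ T])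
  show "finite \<Z>" using fin Z by (intro finite_subset[of \<Z> "Pow A"]) auto
  show "Z \<subseteq> T \<times> T" if "Z \<in> \<Z>" for Z using Z[OF that] by blast
  show "\<not> Z \<subseteq> weak_conn (\<Union>(\<Z> - {Z}))" if Zin: "Z \<in> \<Z>" for Z
  proof
    assume red: "Z \<subseteq> weak_conn (\<Union>(\<Z> - {Z}))"
    have "\<Union>(\<Z> - {Z}) \<subseteq> A - Z" using disj Z Zin by (force simp: disjoint_def)
    then have "Z \<subseteq> weak_conn (A - Z)" using red weak_conn_mono by blast
    then have "connected_digraph V (A - Z)" by (rule connected_digraph_remove[OF con])
    moreover have "balanced (A - Z)" using Z[OF Zin] by (intro balanced_diff fin bal) auto
    moreover have "A - Z \<subset> A" using Z[OF Zin] by blast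
    ultimately show False using min by blast
  qed
qed

section \<open>Counting arcs by position and drift\<close>

lemma card_short_forward_arcs:
  fixes pos :: "'a \<Rightarrow> nat"
  assumes "finite T" "F \<subseteq> T \<times> T" "inj_on pos T"
    and "\<And>u v. (u, v) \<in> F \<Longrightarrow> pos u < pos v \<and> pos v \<le> pos u + s"
  shows "card F \<le> card T * s"
proof -
  let ?f = "\<lambda>(u, v). (u, pos v - pos u)"
  \<comment> \<open>An arc is determined by its tail and its displacement, which takes only s
    values.\<close>
  have "inj_on ?f F"
  proof (rule inj_onI, clarify)
    fix u v v' assume *: "(u, v) \<in> F" "(u, v') \<in> F" "pos v - pos u = pos v' - pos u"
    then have "pos v = pos v'" using assms(4)[OF *(1)] assms(4)[OF *(2)] by linarith
    then show "u = u \<and> v = v'" using * assms(2,3) by (auto dest: inj_onD)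
  qed
  moreover have "?f ` F \<subseteq> T \<times> {1..s}"
  proof clarify
    fix u v assume "(u, v) \<in> F"
    then show "u \<in> T \<and> pos v - pos u \<in> {1..s}" using assms(2) assms(4)[of u v] by auto
  qed
  ultimately have "card F \<le> card (T \<times> {1..s})"
    using assms(1) by (intro card_inj_on_le) auto
  then show ?thesis by (simp add: card_cartesian_product)
qed

text \<open>Take an inclusion-maximal packing. A short closed walk among the remaining arcs would
  contain a further nonempty balanced set of at most g arcs.\<close>

lemma maximal_short_packing:
  assumes "finite E"
  shows "\<exists>\<Z>. disjoint \<Z> \<and> (\<forall>Z\<in>\<Z>. Z \<noteq> {} \<and> Z \<subseteq> E \<and> balanced Z \<and> card Z \<le> g) \<and>
    (\<forall>v l. 0 < l \<longrightarrow> l \<le> g \<longrightarrow> (v, v) \<notin> (E - \<Union>\<Z>) ^^ l)"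
proof -
  let ?P = "\<lambda>\<Z>. disjoint \<Z> \<and> (\<forall>Z\<in>\<Z>. Z \<noteq> {} \<and> Z \<subseteq> E \<and> balanced Z \<and> card Z \<le> g)"
  define S where "S = {\<Z>. ?P \<Z>}"
  have S: "\<Z> \<in> S \<longleftrightarrow> ?P \<Z>" for \<Z> by (simp only: S_def mem_Collect_eq)
  have "S \<subseteq> Pow (Pow E)" unfolding S_def by blast
  then have "finite S" using assms by (auto intro: finite_subset)
  moreover have "{} \<in> S" by (simp add: S)
  ultimately obtain \<Z> where mem: "\<Z> \<in> S" and max: "\<forall>\<Y>\<in>S. \<Z> \<subseteq> \<Y> \<longrightarrow> \<Z> = \<Y>"
    using finite_has_maximal2 by metis
  have Z: "?P \<Z>" using mem by (rule S[THEN iffD1])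
  have "(v, v) \<notin> (E - \<Union>\<Z>) ^^ l" if "0 < l" "l \<le> g" for v l
  proof
    assume "(v, v) \<in> (E - \<Union>\<Z>) ^^ l"
    from closed_walk_contains_balanced[OF this that] obtain Y where
      Y: "Y \<subseteq> E - \<Union>\<Z>" "Y \<noteq> {}" "card Y \<le> g" "balanced Y" by blast
    have "\<forall>Z\<in>\<Z>. disjnt Y Z \<and> disjnt Z Y" using Y(1) by (auto simp: disjnt_def)
    then have "disjoint (insert Y \<Z>)" using Z by (simp add: pairwise_insert)
    moreover have "\<forall>Z\<in>insert Y \<Z>. Z \<noteq> {} \<and> Z \<subseteq> E \<and> balanced Z \<and> card Z \<le> g" using Z Y by blast
    ultimately have "insert Y \<Z> \<in> S" by (intro S[THEN iffD2] conjI)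
    then have "\<Z> = insert Y \<Z>" using max by blast
    then show False using Y by blast
  qed
  then show ?thesis using Z by blast
qed

text \<open>The drift is the sum of all displacements. A backward arc contributes at least -
  \<open>card T\<close> and a forward arc longer than s at least s, so few backward arcs and small
  drift leave few long arcs. Arcs of displacement at most s are counted directly.\<close>

lemma forward_arcs_bound:
  fixes pos :: "'a \<Rightarrow> nat"
  assumes T: "finite T" and E: "E \<subseteq> T \<times> T" and pos: "bij_betw pos T {..<card T}"
    and drift: "(\<Sum>(u, v)\<in>E. int (pos v) - int (pos u)) \<le> int D"
  shows "s * card E \<le> card T * s\<^sup>2 + D + (s + card T) * card {(u, v) \<in> E. pos v \<le> pos u}"
proof -
  have finE: "finite E" using E T finite_subset by blast
  define B where "B = {(u, v) \<in> E. pos v \<le> pos u}"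
  define F where "F = {(u, v) \<in> E. pos u < pos v \<and> pos v \<le> pos u + s}"
  define H where "H = {(u, v) \<in> E. pos u + s < pos v}"
  let ?d = "\<lambda>(u, v). int (pos v) - int (pos u)"
  have split: "E = B \<union> (F \<union> H)" "B \<inter> (F \<union> H) = {}" "F \<inter> H = {}" by (auto simp: B_def F_def H_def)
  have fin: "finite B" "finite F" "finite H" using finE by (auto simp: B_def F_def H_def intro: finite_subset)
  have lt: "pos x < card T" if "x \<in> T" for x using pos that by (auto simp: bij_betw_def)
  have "sum ?d E = sum ?d B + sum ?d F + sum ?d H"
    using split fin by (metis (no_types, lifting) add.assoc finite_UnI sum.union_disjoint)
  moreover have "- int (card T) * int (card B) \<le> sum ?d B"
    using sum_bounded_below[of B "- int (card T)" ?d] E lt by (fastforce simp: B_def mult.commute)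
  moreover have "0 \<le> sum ?d F" by (rule sum_nonneg) (auto simp: F_def)
  moreover have "int s * int (card H) \<le> sum ?d H"
    using sum_bounded_below[of H "int s" ?d] by (fastforce simp: H_def mult.commute)
  ultimately have "int s * int (card H) \<le> int D + int (card T) * int (card B)" using drift by linarith
  then have H: "s * card H \<le> D + card T * card B" by (metis of_nat_add of_nat_le_iff of_nat_mult)
  have "card F \<le> card T * s"
    by (rule card_short_forward_arcs[OF T]) (use E pos in \<open>auto simp: F_def bij_betw_def\<close>)
  then have "s * card F \<le> card T * s\<^sup>2" by (simp add: power2_eq_square)
  moreover have "card E = card B + card F + card H"
    using split fin by (metis add.assoc card_Un_disjoint finite_UnI)
  ultimately have "s * card E \<le> card T * s\<^sup>2 + D + (s + card T) * card B"
    using H by (simp add: algebra_simps)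
  then show ?thesis by (simp only: B_def)
qed

text \<open>E stands for the arcs of j trails inside T: \<open>packing\<close> will come from
  minimality, and \<open>drift\<close> from telescoping along each trail. The 9 is 4 + 5: a maximal
  packing of short balanced sets has at most 4 s t arcs with t = \<open>card T\<close>, and the
  remaining arcs, of large girth, number at most 5 s j.\<close>

lemma sparse_arcs_bound:
  fixes T :: "'a set"
  assumes T: "finite T" and E: "E \<subseteq> T \<times> T" and s: "0 < s" "card T \<le> s\<^sup>2" and j: "card T \<le> j"
    and packing: "\<And>\<Z>. disjoint \<Z> \<Longrightarrow> (\<And>Z. Z \<in> \<Z> \<Longrightarrow> Z \<noteq> {} \<and> Z \<subseteq> E \<and> balanced Z) \<Longrightarrow> card \<Z> \<le> card T"
    and drift: "\<And>h :: 'a \<Rightarrow> int. (\<And>x. x \<in> T \<Longrightarrow> 0 \<le> h x \<and> h x \<le> int (card T)) \<Longrightarrow>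
      (\<Sum>e\<in>E. h (snd e) - h (fst e)) \<le> int (j * card T)"
  shows "card E \<le> 9 * s * j"
proof -
  let ?t = "card T"
  have finE: "finite E" using E T finite_subset by blast
  \<comment> \<open>The length 4 s is twice the radius 2 s used in
    \<open>feedback_arc_bound\<close>, which then leaves at most 3 t / 2 backward arcs because t is
    at most s^2.\<close>
  obtain \<Z> where disj: "disjoint \<Z>" and Z: "\<And>Z. Z \<in> \<Z> \<Longrightarrow> Z \<noteq> {} \<and> Z \<subseteq> E \<and> balanced Z \<and> card Z \<le> 4 * s"
    and girth: "\<And>v l. 0 < l \<Longrightarrow> l \<le> 4 * s \<Longrightarrow> (v, v) \<notin> (E - \<Union>\<Z>) ^^ l"
    using maximal_short_packing[OF finE, of "4 * s"] by blast
  define R where "R = E - \<Union>\<Z>"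
  have "card \<Z> \<le> ?t" using packing[OF disj] Z by blast
  have finZ: "finite Z" if "Z \<in> \<Z>" for Z using Z[OF that] finE finite_subset by blast
  have UE: "\<Union>\<Z> \<subseteq> E" using Z by blast
  have "card (\<Union>\<Z>) \<le> (\<Sum>Z\<in>\<Z>. card Z)" by (rule card_Union_le_sum_card)
  also have "\<dots> \<le> card \<Z> * (4 * s)" using sum_bounded_above[of \<Z> card "4 * s"] Z by simp
  also have "\<dots> \<le> ?t * (4 * s)" using \<open>card \<Z> \<le> ?t\<close> by simp
  finally have U: "card (\<Union>\<Z>) \<le> ?t * (4 * s)" .
  have cE: "card E = card R + card (\<Union>\<Z>)"
    unfolding R_def using UE finE by (metis card_Diff_subset card_mono finite_subset le_add_diff_inverse2)
  have "\<exists>pos. bij_betw pos T {..<?t} \<and>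
      card {(u, v) \<in> R \<inter> T \<times> T. pos v \<le> (pos u :: nat)} * (2 * s)\<^sup>2 \<le> 6 * ?t\<^sup>2"
    by (rule feedback_arc_bound[OF T]) (use girth s in \<open>auto simp: R_def\<close>)
  moreover have RT: "R \<subseteq> T \<times> T" "R \<inter> T \<times> T = R" using E by (auto simp: R_def)
  ultimately obtain pos :: "'a \<Rightarrow> nat" where pos: "bij_betw pos T {..<?t}"
    and bk: "card {(u, v) \<in> R. pos v \<le> pos u} * (2 * s)\<^sup>2 \<le> 6 * ?t\<^sup>2" by auto
  let ?b = "card {(u, v) \<in> R. pos v \<le> pos u}"
  let ?d = "\<lambda>e. int (pos (snd e)) - int (pos (fst e))"
  \<comment> \<open>Deleting balanced sets does not change the drift.\<close>
  have "sum ?d (\<Union>\<Z>) = (\<Sum>Z\<in>\<Z>. sum ?d Z)"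
    using disj finZ by (subst sum.Union_disjoint) (auto simp: disjoint_def comp_def)
  also have "\<dots> = 0"
  proof (rule sum.neutral, rule ballI)
    fix Z assume "Z \<in> \<Z>"
    then have "balanced Z" using Z by blast
    then show "sum ?d Z = 0" using spec[OF iffD1[OF balanced_def], of Z "\<lambda>x. int (pos x)"] by blast
  qed
  finally have "sum ?d R = sum ?d E" unfolding R_def using UE finE by (simp add: sum_diff)
  moreover have "sum ?d E \<le> int (j * ?t)"
    by (rule drift) (use bij_betw_apply[OF pos] in \<open>force simp: less_imp_le\<close>)
  ultimately have "(\<Sum>(u, v)\<in>R. int (pos v) - int (pos u)) \<le> int (j * ?t)"
    by (simp add: case_prod_beta)
  from forward_arcs_bound[OF T RT(1) pos this, of s] have R: "s * card R \<le> ?t * s\<^sup>2 + j * ?t + (s + ?t) * ?b" .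
  have "s\<^sup>2 * (4 * ?b) \<le> 6 * (?t * ?t)" using bk by (simp add: power2_eq_square algebra_simps)
  also have "\<dots> \<le> 6 * (?t * s\<^sup>2)" using s by simp
  finally have "s\<^sup>2 * (4 * ?b) \<le> s\<^sup>2 * (6 * ?t)" by (simp add: algebra_simps)
  then have b: "2 * ?b \<le> 3 * ?t" using s by simp
  have "2 * (s * card R) \<le> 2 * (?t * s\<^sup>2) + 2 * (j * ?t) + (s + ?t) * (2 * ?b)"
    using R by (simp add: algebra_simps)
  also have "\<dots> \<le> 2 * (?t * s\<^sup>2) + 2 * (j * ?t) + (s + ?t) * (3 * ?t)"
    using mult_left_mono[OF b, of "s + ?t"] by simp
  also have "\<dots> = 2 * (?t * s\<^sup>2) + 2 * (j * ?t) + 3 * (s * ?t) + 3 * (?t * ?t)"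
    by (simp add: algebra_simps)
  \<comment> \<open>Every product on the left is at most j s^2, and the coefficients add up to
    10.\<close>
  also have "\<dots> \<le> 2 * (j * s\<^sup>2) + 2 * (j * s\<^sup>2) + 3 * (j * s\<^sup>2) + 3 * (j * s\<^sup>2)"
  proof -
    have "?t * s\<^sup>2 \<le> j * s\<^sup>2" "j * ?t \<le> j * s\<^sup>2" "?t * ?t \<le> j * s\<^sup>2"
      using s j by (auto intro: mult_mono)
    moreover have "s * ?t \<le> j * s\<^sup>2"
      unfolding mult.commute[of j] using s j by (intro mult_mono) (auto simp: power2_eq_square)
    ultimately show ?thesis by linarith
  qed
  also have "\<dots> = 2 * (s * (5 * s * j))" by (simp add: power2_eq_square algebra_simps)
  finally have "card R \<le> 5 * s * j" using s by (simp only: mult_le_cancel1 nat_mult_le_cancel1 zero_less_numeral)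
  moreover have "?t * (4 * s) \<le> j * (4 * s)" using j by (rule mult_le_mono1)
  ultimately have "card E \<le> 5 * s * j + j * (4 * s)" using cE U by linarith
  then show ?thesis by (simp add: algebra_simps)
qed

section \<open>Hall's theorem\<close>

text \<open>Halmos-Vaughan induction. If a nonempty proper J is tight, represent J and then the rest
  outside the union over J. Otherwise every such J has one element to spare, so one index may take
  any element of its set.\<close>

lemma hall_marriage:
  assumes "finite I" "\<And>i. i \<in> I \<Longrightarrow> finite (X i)"
    and "\<And>J. J \<subseteq> I \<Longrightarrow> card J \<le> card (\<Union>i\<in>J. X i)"
  shows "\<exists>f. inj_on f I \<and> (\<forall>i\<in>I. f i \<in> X i)"
  using assms
proof (induction "card I" arbitrary: I X rule: less_induct)
  case less
  note finI = less.prems(1) and finX = less.prems(2) and hall = less.prems(3)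
  have finU: "finite (\<Union>i\<in>J. X i)" if "J \<subseteq> I" for J
    using that finI finX by (meson finite_UN_I finite_subset subsetD)
  consider "I = {}" | J where "J \<noteq> {}" "J \<subset> I" "card (\<Union>i\<in>J. X i) \<le> card J"
    | "I \<noteq> {}" "\<And>J. J \<noteq> {} \<Longrightarrow> J \<subset> I \<Longrightarrow> card J < card (\<Union>i\<in>J. X i)"
    by (meson not_le)
  then show ?case
  proof cases
    case 1
    then show ?thesis by simp
  next
    case (2 J)
    let ?U = "\<Union>i\<in>J. X i"
    have J: "card (I - J) < card I" "card J < card I" "finite J" "J \<subseteq> I"
      using 2 finI by (auto intro!: psubset_card_mono intro: finite_subset)
    have "\<exists>f. inj_on f J \<and> (\<forall>i\<in>J. f i \<in> X i)"
      by (rule less.hyps[OF J(2,3)]) (use J finX hall in blast)+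
    then obtain f where f: "inj_on f J" "\<And>i. i \<in> J \<Longrightarrow> f i \<in> X i" by blast
    \<comment> \<open>Hall's condition for K outside U follows from that for
      \<open>K \<union> J\<close>, as U has at most \<open>card J\<close> elements.\<close>
    have "\<exists>g. inj_on g (I - J) \<and> (\<forall>i\<in>I - J. g i \<in> X i - ?U)"
    proof (rule less.hyps[OF J(1)])
      fix K assume K: "K \<subseteq> I - J"
      have "card K + card J = card (K \<union> J)"
        using K J finI by (subst card_Un_disjoint) (auto intro: finite_subset)
      also have "\<dots> \<le> card (\<Union>i\<in>K \<union> J. X i)" using K J by (intro hall) auto
      also have "(\<Union>i\<in>K \<union> J. X i) = (\<Union>i\<in>K. X i - ?U) \<union> ?U" by blast
      also have "card \<dots> \<le> card (\<Union>i\<in>K. X i - ?U) + card ?U" by (rule card_Un_le)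
      finally show "card K \<le> card (\<Union>i\<in>K. X i - ?U)" using 2(3) by linarith
    qed (use finI finX in auto)
    then obtain g where g: "inj_on g (I - J)" "\<And>i. i \<in> I - J \<Longrightarrow> g i \<in> X i - ?U" by blast
    let ?h = "\<lambda>i. if i \<in> J then f i else g i"
    have "inj_on ?h I"
    proof (rule inj_onI)
      fix i k assume ik: "i \<in> I" "k \<in> I" "?h i = ?h k"
      show "i = k"
      proof (cases "i \<in> J"; cases "k \<in> J")
        assume "i \<in> J" "k \<in> J"
        then show ?thesis using ik f(1) by (auto dest: inj_onD)
      next
        assume "i \<in> J" "k \<notin> J"
        then show ?thesis using ik f(2)[of i] g(2)[of k] by auto
      next
        assume "i \<notin> J" "k \<in> J"
        then show ?thesis using ik f(2)[of k] g(2)[of i] by auto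
      next
        assume "i \<notin> J" "k \<notin> J"
        then show ?thesis using ik g(1) by (auto dest: inj_onD)
      qed
    qed
    moreover have "\<forall>i\<in>I. ?h i \<in> X i" using f(2) g(2) by auto
    ultimately show ?thesis by blast
  next
    case 3
    then obtain i where i: "i \<in> I" by blast
    have "card {i} \<le> card (\<Union>k\<in>{i}. X k)" using i by (intro hall) auto
    then have "X i \<noteq> {}" by auto
    then obtain x where x: "x \<in> X i" by blast
    have "card (I - {i}) < card I" using finI i by (rule card_Diff1_less)
    then have "\<exists>g. inj_on g (I - {i}) \<and> (\<forall>k\<in>I - {i}. g k \<in> X k - {x})"
    proof (rule less.hyps)
      fix K assume K: "K \<subseteq> I - {i}"
      show "card K \<le> card (\<Union>k\<in>K. X k - {x})"
      proof (cases "K = {}")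
        case False
        have "K \<subset> I" using K i by blast
        with False have "card K < card (\<Union>k\<in>K. X k)" by (rule 3(2))
        also have "\<dots> \<le> card ((\<Union>k\<in>K. X k - {x}) \<union> {x})"
          using finU[of K] \<open>K \<subset> I\<close> by (intro card_mono) (auto intro: finite_subset[of _ "\<Union>k\<in>K. X k"])
        also have "\<dots> \<le> card (\<Union>k\<in>K. X k - {x}) + card {x}" by (rule card_Un_le)
        finally show ?thesis by simp
      qed simp
    qed (use finI finX in auto)
    then obtain g where g: "inj_on g (I - {i})" "\<And>k. k \<in> I - {i} \<Longrightarrow> g k \<in> X k - {x}" by blast
    have "inj_on (g(i := x)) I"
      using g by (force simp: inj_on_def)
    moreover have "\<forall>k\<in>I. (g(i := x)) k \<in> X k" using g(2) x by auto
    ultimately show ?thesis by blast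
  qed
qed

section \<open>Walks and Euler tours\<close>

lemma relpow_walk_segment:
  assumes "\<And>i. i < m \<Longrightarrow> (w i, w (Suc i)) \<in> A" "p \<le> q" "q \<le> m"
  shows "(w p, w q) \<in> A ^^ (q - p)"
  unfolding relpow_fun_conv using assms by (intro exI[of _ "\<lambda>i. w (p + i)"]) auto

text \<open>A shortest walk repeats no vertex. This allows powers to be handled through lengths of
  walks.\<close>

lemma relpow_dpath:
  assumes "(u, v) \<in> A ^^ l"
  shows "\<exists>xs. dpath A xs \<and> hd xs = u \<and> last xs = v \<and> length xs - 1 \<le> l"
proof -
  define m where "m = (LEAST l. (u, v) \<in> A ^^ l)"
  have "(u, v) \<in> A ^^ m" unfolding m_def by (rule LeastI) (rule assms)
  have min: "m \<le> l'" if "(u, v) \<in> A ^^ l'" for l' unfolding m_def by (rule Least_le) (rule that)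
  from \<open>(u, v) \<in> A ^^ m\<close> obtain w where w: "w 0 = u" "w m = v"
    and arc: "\<And>i. i < m \<Longrightarrow> (w i, w (Suc i)) \<in> A"
    by (auto simp: relpow_fun_conv)
  have "inj_on w {..m}"
  proof (rule linorder_inj_onI)
    fix i j assume ij: "i < j" "i \<in> {..m}" "j \<in> {..m}"
    show "w i \<noteq> w j"
    proof
      assume eq: "w i = w j"
      have "(w 0, w i) \<in> A ^^ (i - 0)" "(w j, w m) \<in> A ^^ (m - j)"
        by (rule relpow_walk_segment[of m w A]; use ij arc in simp)+
      then have "(u, v) \<in> A ^^ (i + (m - j))" using eq w by (auto simp: relpow_add)
      then show False using min[of "i + (m - j)"] ij by auto
    qed
  qed auto
  then have "dpath A (map w [0..<Suc m])"
    using arc by (auto simp: dpath_def distinct_map atLeast0LessThan lessThan_Suc_atMost simp del: upt_Suc)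
  moreover have "hd (map w [0..<Suc m]) = u" "last (map w [0..<Suc m]) = v"
    using w by (simp_all add: hd_map last_map del: upt_Suc)
  ultimately show ?thesis using min[OF assms] by (intro exI[of _ "map w [0..<Suc m]"]) auto
qed

lemma relpow_digraph_power:
  "(u, v) \<in> A ^^ l \<Longrightarrow> l \<le> k \<Longrightarrow> u \<noteq> v \<Longrightarrow> (u, v) \<in> digraph_power A k"
  unfolding digraph_power_def by (auto dest!: relpow_dpath)

text \<open>A path from u stays in V and repeats no vertex, so it has at most
  \<open>card V - 1\<close> arcs.\<close>

lemma reachable_digraph_power:
  assumes V: "finite V" "A \<subseteq> V \<times> V" "card V - 1 \<le> k"
    and uv: "u \<in> V" "u \<noteq> v" "(u, v) \<in> A\<^sup>*"
  shows "(u, v) \<in> digraph_power A k"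
proof -
  obtain l where l: "(u, v) \<in> A ^^ l" using uv(3) rtrancl_imp_relpow by blast
  obtain xs where xs: "dpath A xs" "hd xs = u" "last xs = v" using relpow_dpath[OF l] by blast
  have "xs ! i \<in> V" if "i < length xs" for i
  proof (cases i)
    case 0
    then show ?thesis using xs uv(1) that by (auto simp: dpath_def hd_conv_nth)
  next
    case (Suc j)
    then have "(xs ! j, xs ! i) \<in> A" using xs(1) that by (auto simp: dpath_def)
    then show ?thesis using V(2) by blast
  qed
  then have "set xs \<subseteq> V" by (auto simp: in_set_conv_nth)
  then have "card (set xs) \<le> card V" by (rule card_mono[OF V(1)])
  then have "length xs - 1 \<le> k" using xs(1) V(3) by (auto simp: dpath_def distinct_card)
  then show ?thesis unfolding digraph_power_def using xs uv(2) by blast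
qed

lemma hamiltonian_complete:
  assumes "finite V" "2 \<le> card V" "\<And>u v. u \<in> V \<Longrightarrow> v \<in> V \<Longrightarrow> u \<noteq> v \<Longrightarrow> (u, v) \<in> B"
  shows "hamiltonian V B"
proof -
  obtain xs where xs: "set xs = V" "distinct xs" using finite_distinct_list[OF assms(1)] by blast
  then have len: "2 \<le> length xs" using assms(2) distinct_card by metis
  have arc: "(xs ! i, xs ! j) \<in> B" if "i < length xs" "j < length xs" "i \<noteq> j" for i j
    using assms(3) xs that by (metis nth_eq_iff_index_eq nth_mem)
  have "xs \<noteq> []" using len by auto
  then have "(last xs, hd xs) \<in> B" unfolding last_conv_nth[OF \<open>xs \<noteq> []\<close>] hd_conv_nth[OF \<open>xs \<noteq> []\<close>]
    using len by (intro arc) auto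
  then show ?thesis unfolding hamiltonian_def using xs len arc by (intro exI[of _ xs]) auto
qed

lemma eulerian_balanced:
  assumes "eulerian V A"
  shows "balanced A"
proof -
  obtain es where es: "distinct es" "set es = A"
    and adj: "\<And>i. Suc i < length es \<Longrightarrow> snd (es ! i) = fst (es ! Suc i)"
    and closed: "es \<noteq> [] \<Longrightarrow> snd (last es) = fst (hd es)"
    using assms unfolding eulerian_def by blast
  \<comment> \<open>The value past the end of the list is the start of the tour, so that w is a
    closed walk; this also covers the empty list.\<close>
  define w where "w i = (if i < length es then fst (es ! i) else fst (hd es))" for i
  have arc: "(w i, w (Suc i)) = es ! i" if "i < length es" for i
  proof -
    have "w (Suc i) = snd (es ! i)"
    proof (cases "Suc i < length es")
      case True
      then show ?thesis using adj by (simp add: w_def)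
    next
      case False
      then have "i = length es - 1" "es \<noteq> []" using that by auto
      then show ?thesis using closed False by (simp add: w_def last_conv_nth)
    qed
    then show ?thesis using that by (simp add: w_def)
  qed
  have "inj_on (\<lambda>i. (w i, w (Suc i))) {..<length es}"
    using es(1) arc by (auto simp: inj_on_def nth_eq_iff_index_eq)
  moreover have "w (length es) = w 0" by (cases es) (simp_all add: w_def)
  ultimately have "balanced ((\<lambda>i. (w i, w (Suc i))) ` {..<length es})" by (rule balanced_closed_walk)
  moreover have "(\<lambda>i. (w i, w (Suc i))) ` {..<length es} = (!) es ` {..<length es}"
    using arc by (intro image_cong) auto
  moreover have "(!) es ` {..<length es} = A"
    using es(2) by (simp add: nth_image[of "length es" es, simplified, symmetric] atLeast0LessThan[symmetric])
  ultimately show ?thesis by simp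
qed

text \<open>Translates a consecutive arc list of \<open>Graph_Theory\<close> into a vertex sequence,
  in which windows are easy to describe.\<close>

lemma cas_vertex_sequence:
  assumes "pre_digraph.cas G u p v" "tail G = fst" "head G = snd"
  shows "\<exists>w. w 0 = u \<and> w (length p) = v \<and> (\<forall>i<length p. p ! i = (w i, w (Suc i)))"
  using assms(1)
proof (induction p arbitrary: u)
  case Nil
  then show ?case by (intro exI[of _ "\<lambda>_. u"]) (simp add: pre_digraph.cas.simps)
next
  case (Cons e p)
  then have e: "fst e = u" "pre_digraph.cas G (snd e) p v"
    using assms(2,3) by (simp_all add: pre_digraph.cas.simps)
  from Cons.IH[OF e(2)] obtain w where w: "w 0 = snd e" "w (length p) = v"
    "\<forall>i<length p. p ! i = (w i, w (Suc i))" by blast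
  let ?w = "case_nat u w"
  have "(e # p) ! i = (?w i, ?w (Suc i))" if "i < length (e # p)" for i
    using that w e by (cases i) (auto simp: prod_eq_iff)
  then show ?case using w by (intro exI[of _ ?w]) auto
qed

text \<open>Supplies a tour of the minimal subdigraph, which does not inherit one from the given
  tour. Balance gives equal degrees, and Euler's theorem from \<open>Graph_Theory\<close>
  applies.\<close>

lemma euler_tour:
  assumes fin: "finite V" and A: "A \<subseteq> V \<times> V" and con: "connected_digraph V A" and bal: "balanced A"
  shows "\<exists>w m. bij_betw (\<lambda>i. (w i, w (Suc i))) {..<m} A \<and> w m = w 0"
proof -
  define G where "G = \<lparr>verts = V, arcs = A, tail = fst, head = snd\<rparr>"
  have finA: "finite A" using fin A finite_subset by blast
  interpret fin_digraph G
    by unfold_locales (use A fin finA in \<open>auto simp: G_def\<close>)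
  have vertsG: "verts G = V" and arcsG: "arcs G = A" by (simp_all add: G_def)
  have sym: "parcs (mk_symmetric G) = A \<union> A\<inverse>"
    unfolding parcs_mk_symmetric by (auto simp: G_def)
  have "(u, v) \<in> rtrancl_on V (A \<union> A\<inverse>)" if "u \<in> V" "v \<in> V" for u v
    using con that A by (intro rtrancl_consistent_rtrancl_on) (auto simp: connected_digraph_def)
  then have "Digraph_Component.connected G"
    using con unfolding Digraph_Component.connected_def connected_digraph_def strongly_connected_def
    by (auto simp: reachable_def sym vertsG)
  moreover have "in_degree G u = out_degree G u" for u
    using balanced_degrees[OF finA bal] by (simp add: in_degree_def out_degree_def in_arcs_def out_arcs_def G_def)
  ultimately obtain u p where "euler_trail u p u" using closed_euler1 by blast
  then have p: "distinct p" "set p = A" "cas u p u"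
    by (auto simp: euler_trail_def trail_def awalk_def arcsG)
  from cas_vertex_sequence[OF p(3)] obtain w where w: "w 0 = u" "w (length p) = u"
    "\<And>i. i < length p \<Longrightarrow> p ! i = (w i, w (Suc i))" by (auto simp: G_def)
  have "bij_betw ((!) p) {..<length p} A" using bij_betw_nth[OF p(1)] p(2) by blast
  then have "bij_betw (\<lambda>i. (w i, w (Suc i))) {..<length p} A"
    using w(3) by (subst bij_betw_cong[of _ _ "(!) p"]) auto
  then show ?thesis using w by blast
qed

section \<open>Size of the exponent\<close>

text \<open>The fraction p / q is a rational lower bound for log_2 n, and \<open>fourth\<close> says
  that sqrt n is at most (p / q)^2 / 2. Multiplying by sqrt n gives the claim.\<close>

lemma le_sqrt_log_sqr:
  assumes "0 < n" "0 < q" and p: "2 ^ p \<le> n ^ q" and fourth: "4 * n * q ^ 4 \<le> p ^ 4"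
  shows "n \<le> nat \<lceil>(1/2) * sqrt (real n) * (log 2 (real n))\<^sup>2\<rceil>"
proof -
  have "real (2 ^ p) \<le> real (n ^ q)" using p by (rule of_nat_mono)
  then have "log 2 (2 ^ p) \<le> log 2 (real n ^ q)"
    using assms(1) by (intro log_mono) auto
  then have "real p / real q \<le> log 2 (real n)"
    using assms(1,2) by (simp add: log_nat_power field_simps)
  then have log: "(real p / real q)\<^sup>2 \<le> (log 2 (real n))\<^sup>2" by (intro power_mono) auto
  have "real (4 * n * q ^ 4) \<le> real (p ^ 4)" using fourth by (rule of_nat_mono)
  then have "real n \<le> ((real p / real q)\<^sup>2 / 2)\<^sup>2"
    using assms(2) by (simp add: field_simps power2_eq_square power4_eq_xxxx)
  then have "sqrt (real n) \<le> (real p / real q)\<^sup>2 / 2" by (intro real_le_lsqrt) auto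
  then have "sqrt (real n) \<le> (log 2 (real n))\<^sup>2 / 2" using log by linarith
  then have "sqrt (real n) * sqrt (real n) \<le> sqrt (real n) * ((log 2 (real n))\<^sup>2 / 2)"
    by (rule mult_left_mono) simp
  then have "real n \<le> (1/2) * sqrt (real n) * (log 2 (real n))\<^sup>2" by simp
  then show ?thesis by linarith
qed

text \<open>For n = 2 the bound fails without the ceiling.\<close>
lemma small_order_exponent:
  assumes n: "2 \<le> n" "n < 2048"
  shows "n - 1 \<le> nat \<lceil>(1/2) * sqrt (real n) * (log 2 (real n))\<^sup>2\<rceil>"
proof -
  let ?k = "nat \<lceil>(1/2) * sqrt (real n) * (log 2 (real n))\<^sup>2\<rceil>"
  have log_pos: "0 < log 2 (real n)" using n by simp
  show ?thesis
  proof (cases "n < 8")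
    case True
    then have "n \<in> {2, 3, 4, 5, 6, 7}" using n by auto
    then consider "n = 2" | "n = 3" | "n \<in> {4, 5, 6, 7}" by blast
    then show ?thesis
    proof cases
      case 1
      have "0 < (1/2) * sqrt (real n) * (log 2 (real n))\<^sup>2" by (intro mult_pos_pos zero_less_power log_pos) (use n in auto)
      then show ?thesis using 1 by linarith
    next
      case 2
      \<comment> \<open>For n = 3 the criterion \<open>le_sqrt_log_sqr\<close> fails, but the value
        exceeds 1 and the ceiling lifts it to 2.\<close>
      have "log 2 (2 ^ 3) \<le> log 2 ((3::real) ^ 2)" by (intro log_mono) auto
      then have "3 / 2 \<le> log 2 (3::real)" by (simp only: log_nat_power) simp
      then have "(3 / 2)\<^sup>2 \<le> (log 2 (3::real))\<^sup>2" by (intro power_mono) auto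
      moreover have "1 \<le> sqrt 3" by simp
      ultimately have "1 * (3 / 2)\<^sup>2 \<le> sqrt 3 * (log 2 (3::real))\<^sup>2" by (intro mult_mono) auto
      then have "1 < (1/2) * sqrt (real n) * (log 2 (real n))\<^sup>2" using 2 by (simp add: power2_eq_square)
      then show ?thesis using 2 by linarith
    next
      case 3
      have "n \<le> ?k" if "n = 4" using that by (intro le_sqrt_log_sqr[of n 1 2]) auto
      moreover have "n \<le> ?k" if "n = 5" using that by (intro le_sqrt_log_sqr[of n 4 9]) auto
      moreover have "n \<le> ?k" if "n \<in> {6, 7}" using that by (intro le_sqrt_log_sqr[of n 2 5]) auto
      ultimately have "n \<le> ?k" using 3 by blast
      then show ?thesis by simp
    qed
  next
    case False
    obtain a where a: "2 ^ a \<le> n" "n < 2 ^ Suc a"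
      using ex_power_ivl1[of 2 n] n by auto
    have "2 ^ 3 < (2::nat) ^ Suc a" "2 ^ a < (2::nat) ^ 11" using a n False by simp_all
    then have "3 \<le> a" "a \<le> 10" by (simp_all only: power_strict_increasing_iff)
    then have "a \<in> {3, 4, 5, 6, 7, 8, 9, 10}" by auto
    \<comment> \<open>With a = floor (log_2 n) as lower bound for the logarithm, this inequality
      holds for a from 3 to 10 and fails at 11, whence the threshold 2048 = 2^11.\<close>
    then have "4 * 2 ^ Suc a \<le> a ^ 4" by auto
    then have "n \<le> ?k" using a n by (intro le_sqrt_log_sqr[of n 1 a]) auto
    then show ?thesis by simp
  qed
qed

text \<open>Here \<open>9 * s + 2\<close> is the window length and three windows bound a step of the
  cycle. With s = ceiling (sqrt n), 27 s + 6 is at most 60 sqrt n, while log_2 n is at least 11, so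
  the exponent is at least half of 120 sqrt n.\<close>

lemma large_order_exponent:
  assumes n: "2048 \<le> n"
  obtains s where "0 < s" "n \<le> s\<^sup>2"
    and "3 * (9 * s + 2) \<le> nat \<lceil>(1/2) * sqrt (real n) * (log 2 (real n))\<^sup>2\<rceil>"
proof
  define s where "s = nat \<lceil>sqrt (real n)\<rceil>"
  have s: "sqrt (real n) \<le> real s" "real s \<le> sqrt (real n) + 1"
    unfolding s_def by (simp_all add: real_nat_ceiling_ge)
  have "1 \<le> sqrt (real n)" using n by simp
  show "0 < nat \<lceil>sqrt (real n)\<rceil>" using \<open>1 \<le> sqrt (real n)\<close> by linarith
  have "(sqrt (real n))\<^sup>2 \<le> (real s)\<^sup>2" using s by (intro power_mono) auto
  then have "real n \<le> real (s\<^sup>2)" by simp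
  then show "n \<le> (nat \<lceil>sqrt (real n)\<rceil>)\<^sup>2" unfolding s_def by (simp only: of_nat_le_iff)
  have "log 2 (2 ^ 11) \<le> log 2 (real n)" using n by (intro log_mono) auto
  then have "11 \<le> log 2 (real n)" by (simp only: log_nat_power) simp
  then have "11\<^sup>2 \<le> (log 2 (real n))\<^sup>2" by (intro power_mono) auto
  then have "sqrt (real n) * 120 \<le> sqrt (real n) * (log 2 (real n))\<^sup>2"
    by (intro mult_left_mono) auto
  moreover have "real (3 * (9 * s + 2)) = 27 * real s + 6" by simp
  then have "real (3 * (9 * s + 2)) \<le> 60 * sqrt (real n)"
    using s \<open>1 \<le> sqrt (real n)\<close> by linarith
  ultimately have "real (3 * (9 * s + 2)) \<le> (1/2) * sqrt (real n) * (log 2 (real n))\<^sup>2"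
    by linarith
  then show "3 * (9 * nat \<lceil>sqrt (real n)\<rceil> + 2) \<le> nat \<lceil>(1/2) * sqrt (real n) * (log 2 (real n))\<^sup>2\<rceil>"
    unfolding s_def by linarith
qed

section \<open>The Hamiltonian cycle\<close>

lemma minimal_balanced_connected:
  assumes "finite A" "connected_digraph V A" "balanced A"
  obtains B where "B \<subseteq> A" "connected_digraph V B" "balanced B"
    "\<And>C. C \<subset> B \<Longrightarrow> balanced C \<Longrightarrow> \<not> connected_digraph V C"
proof -
  let ?P = "\<lambda>B. B \<subseteq> A \<and> connected_digraph V B \<and> balanced B"
  have "?P A" using assms by simp
  from ex_has_least_nat[of ?P A card, OF this] obtain B
    where B: "?P B" and least: "\<forall>C. ?P C \<longrightarrow> card B \<le> card C" by blast
  show thesis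
  proof (rule that)
    fix C assume C: "C \<subset> B" "balanced C"
    show "\<not> connected_digraph V C"
    proof
      assume "connected_digraph V C"
      then have "card B \<le> card C" using least B C by blast
      moreover have "finite B" using B assms(1) finite_subset by blast
      ultimately show False using psubset_card_mono[OF _ C(1)] by simp
    qed
  qed (use B in auto)
qed

text \<open>This is Hall's condition for the windows. A window of \<open>9 * s + 2\<close> positions
  contains \<open>9 * s + 1\<close> arcs, one more than \<open>sparse_arcs_bound\<close> allows per
  window if the windows meet fewer vertices than their number.\<close>

lemma tour_window_union:
  fixes w :: "nat \<Rightarrow> 'a"
  assumes V: "finite V" "A \<subseteq> V \<times> V" and con: "connected_digraph V A" and bal: "balanced A"
    and min: "\<And>B. B \<subset> A \<Longrightarrow> balanced B \<Longrightarrow> \<not> connected_digraph V B"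
    and tour: "bij_betw (\<lambda>i. (w i, w (Suc i))) {..<m} A"
    and s: "0 < s" "card V \<le> s\<^sup>2" and L: "L = 9 * s + 2" and J: "J \<subseteq> {..<m div L}"
  shows "card J \<le> card (\<Union>i\<in>J. w ` {i * L..<i * L + L})"
proof (rule ccontr)
  define T where "T = (\<Union>i\<in>J. w ` {i * L..<i * L + L})"
  \<comment> \<open>Positions of arcs with both ends in the same window; the last position of a
    window starts an arc leaving it, hence \<open>L - 1\<close>.\<close>
  define P where "P = (\<Union>i\<in>J. {i * L..<i * L + (L - 1)})"
  let ?arc = "\<lambda>i. (w i, w (Suc i))"
  assume "\<not> ?thesis"
  then have less: "card T < card J" by (simp add: T_def)
  have finJ: "finite J" using J finite_subset by blast
  then have finT: "finite T" by (auto simp: T_def)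
  have finA: "finite A" using V finite_subset by blast
  have L0: "0 < L" by (simp add: L)
  have window: "i * L + L \<le> m" if "i \<in> J" for i
  proof -
    have "Suc i \<le> m div L" using that J by auto
    then have "Suc i * L \<le> m div L * L" by (rule mult_le_mono1)
    also have "\<dots> \<le> m" by simp
    finally show ?thesis by simp
  qed
  have P: "P \<subseteq> {..<m}" using window L0 by (fastforce simp: P_def)
  have inj: "inj_on ?arc P" using tour P by (meson bij_betw_def inj_on_subset)
  have img: "?arc ` P \<subseteq> A" using tour P by (auto simp: bij_betw_def)
  have arcs: "w k \<in> V" if "k < m" for k using tour V(2) that by (auto simp: bij_betw_def)
  have "T \<subseteq> V"
  proof -
    have "k < m" if "i \<in> J" "k < i * L + L" for i k using window[OF that(1)] that(2) by simp
    then show ?thesis using arcs by (auto simp: T_def)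
  qed
  then have cT: "card T \<le> s\<^sup>2" using card_mono[OF V(1)] s(2) le_trans by blast
  have ET: "?arc ` P \<subseteq> T \<times> T"
  proof
    fix e assume "e \<in> ?arc ` P"
    then obtain i k where ik: "i \<in> J" "i * L \<le> k" "k < i * L + (L - 1)" "e = (w k, w (Suc k))"
      by (auto simp: P_def)
    then have "k \<in> {i * L..<i * L + L}" "Suc k \<in> {i * L..<i * L + L}" by auto
    then show "e \<in> T \<times> T" using ik(1,4) unfolding T_def by blast
  qed
  have disj: "{i * L..<i * L + (L - 1)} \<inter> {k * L..<k * L + (L - 1)} = {}" if "i < k" for i k
  proof -
    have "Suc i * L \<le> k * L" using that by (intro mult_le_mono1) simp
    then show ?thesis by auto
  qed
  then have disj': "{i * L..<i * L + (L - 1)} \<inter> {k * L..<k * L + (L - 1)} = {}" if "i \<noteq> k" for i k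
    using that by (metis Int_commute nat_neq_iff)
  have sumP: "sum f P = (\<Sum>i\<in>J. \<Sum>k = i * L..<i * L + (L - 1). f k)" for f :: "nat \<Rightarrow> int"
    unfolding P_def using finJ disj' by (intro sum.UNION_disjoint) auto
  have "card P = (\<Sum>i\<in>J. card {i * L..<i * L + (L - 1)})"
    unfolding P_def using finJ disj' by (intro card_UN_disjoint) auto
  then have cP: "card (?arc ` P) = card J * (9 * s + 1)"
    using card_image[OF inj] by (simp add: L)
  have "card (?arc ` P) \<le> 9 * s * card J"
  proof (rule sparse_arcs_bound[OF finT ET s(1) cT])
    show "card T \<le> card J" using less by simp
    fix \<Z> :: "('a \<times> 'a) set set"
    assume "disjoint \<Z>" "\<And>Z. Z \<in> \<Z> \<Longrightarrow> Z \<noteq> {} \<and> Z \<subseteq> ?arc ` P \<and> balanced Z"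
    then show "card \<Z> \<le> card T"
      using img ET by (intro minimal_balanced_packing[OF finA con bal min finT]) blast+
  next
    fix h :: "'a \<Rightarrow> int" assume h: "\<And>x. x \<in> T \<Longrightarrow> 0 \<le> h x \<and> h x \<le> int (card T)"
    have "(\<Sum>e\<in>?arc ` P. h (snd e) - h (fst e)) = (\<Sum>k\<in>P. h (w (Suc k)) - h (w k))"
      by (simp add: sum.reindex[OF inj])
    \<comment> \<open>Within a window the sum telescopes to the difference of the weights at its two
      ends.\<close>
    also have "\<dots> = (\<Sum>i\<in>J. h (w (i * L + (L - 1))) - h (w (i * L)))"
      unfolding sumP by (intro sum.cong refl) (simp add: sum_Suc_diff'[of _ _ "\<lambda>k. h (w k)"])
    also have "\<dots> \<le> int (card J) * int (card T)"
    proof (rule sum_bounded_above)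
      fix i assume i: "i \<in> J"
      have "i * L + (L - 1) \<in> {i * L..<i * L + L}" "i * L \<in> {i * L..<i * L + L}" using L0 by auto
      then have "w (i * L + (L - 1)) \<in> T" "w (i * L) \<in> T" using i unfolding T_def by blast+
      then show "h (w (i * L + (L - 1))) - h (w (i * L)) \<le> int (card T)" using h by (meson diff_le_eq le_add_same_cancel1 order_trans)
    qed
    finally show "(\<Sum>e\<in>?arc ` P. h (snd e) - h (fst e)) \<le> int (card J * card T)" by simp
  qed
  then have "card J = 0" unfolding cP by (simp add: algebra_simps)
  then show False using less by simp
qed

text \<open>Each vertex gets one occurrence on the tour, a representative one inside its window.
  Read in tour order, these occurrences form the cycle: every full window contains one, so gaps are
  at most 2 L, or 3 L across the closing point of the tour.\<close>

lemma hamiltonian_of_window_representatives: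
  fixes w :: "nat \<Rightarrow> 'a"
  assumes V: "finite V" "2 \<le> card V" "w ` {..<m} = V"
    and walk: "\<And>i. i < m \<Longrightarrow> (w i, w (Suc i)) \<in> A" and closed: "w m = w 0"
    and L: "0 < L" "3 * L \<le> k"
    and f: "inj_on f {..<m div L}" "\<And>i. i < m div L \<Longrightarrow> f i \<in> w ` {i * L..<i * L + L}"
  shows "hamiltonian V (digraph_power A k)"
proof -
  let ?q = "m div L"
  have qL: "i * L + L \<le> m" if "i < ?q" for i
  proof -
    have "Suc i * L \<le> ?q * L" using that by (intro mult_le_mono1) simp
    also have "\<dots> \<le> m" by simp
    finally show ?thesis by simp
  qed
  \<comment> \<open>Since f is injective, v represents at most one window; a vertex representing
    none takes any occurrence.\<close>
  have "\<exists>p<m. w p = v \<and> (\<forall>i<?q. f i = v \<longrightarrow> p \<in> {i * L..<i * L + L})" if v: "v \<in> V" for v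
  proof (cases "v \<in> f ` {..<?q}")
    case True
    then obtain i where i: "i < ?q" "f i = v" by auto
    then obtain p where p: "p \<in> {i * L..<i * L + L}" "w p = v" using f(2) by fastforce
    moreover have "i' = i" if "i' < ?q" "f i' = v" for i' using f(1) i that by (auto dest: inj_onD)
    ultimately show ?thesis using qL[OF i(1)] by (intro exI[of _ p]) auto
  next
    case False
    obtain p where "p < m" "w p = v" using V(3) v by auto
    moreover have "f i \<noteq> v" if "i < ?q" for i using False that by blast
    ultimately show ?thesis by blast
  qed
  then obtain occ where occ: "\<And>v. v \<in> V \<Longrightarrow> occ v < m \<and> w (occ v) = v \<and>
      (\<forall>i<?q. f i = v \<longrightarrow> occ v \<in> {i * L..<i * L + L})" by metis
  define P where "P = occ ` V"
  define ps where "ps = sorted_list_of_set P"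
  have finP: "finite P" using V(1) by (simp add: P_def)
  have ps: "set ps = P" "sorted_wrt (<) ps" "distinct ps"
    using finP by (simp_all add: ps_def strict_sorted_list_of_set)
  have wP: "w ` P = V" using occ by (auto simp: P_def image_iff)
  have injP: "inj_on w P" using occ by (auto simp: P_def inj_on_def)
  have "card V = length ps" using card_image[OF injP] wP distinct_card[OF ps(3)] ps(1) by simp
  then have len: "2 \<le> length ps" using V(2) by simp
  then have ne: "ps \<noteq> []" by auto
  have psP: "ps ! i \<in> P" if "i < length ps" for i using ps(1) that nth_mem by blast
  have ltm: "p < m" if "p \<in> P" for p using that occ by (auto simp: P_def)
  have mono: "ps ! i < ps ! j" if "i < j" "j < length ps" for i j
    using sorted_wrt_nth_less[OF ps(2)] that by blast
  have hit: "\<exists>j<length ps. ps ! j \<in> {i * L..<i * L + L}" if "i < ?q" for i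
  proof -
    have "w ` {i * L..<i * L + L} \<subseteq> V" using V(3) qL[OF that] by auto
    then have "f i \<in> V" using f(2)[OF that] by blast
    then have "occ (f i) \<in> P" "occ (f i) \<in> {i * L..<i * L + L}" using occ that by (auto simp: P_def)
    then show ?thesis using ps(1) by (metis in_set_conv_nth)
  qed
  have gap: "ps ! Suc i - ps ! i \<le> 2 * L" if i: "Suc i < length ps" for i
  proof (rule ccontr)
    assume "\<not> ?thesis"
    then have far: "ps ! i + 2 * L < ps ! Suc i" by linarith
    \<comment> \<open>A gap beyond 2 L would contain the whole next window \<open>Suc c\<close>, in
      which \<open>hit\<close> provides a chosen position.\<close>
    define c where "c = ps ! i div L"
    have c: "c * L \<le> ps ! i" "ps ! i < c * L + L"
      using dividend_less_div_times[OF L(1), of "ps ! i"] by (simp_all add: c_def add.commute)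
    have "ps ! Suc i < m" using ltm psP i by blast
    then have "(c + 2) * L \<le> m" using far c by simp
    then have "c + 2 \<le> ?q" using L(1) by (simp add: less_eq_div_iff_mult_less_eq)
    then obtain j where j: "j < length ps" "ps ! j \<in> {Suc c * L..<Suc c * L + L}"
      using hit[of "Suc c"] by auto
    then have "ps ! i < ps ! j" "ps ! j < ps ! Suc i" using c far by auto
    then have "i < j" "j < Suc i" using mono i j(1) by (metis less_asym' nat_neq_iff Suc_lessD)+
    then show False by simp
  qed
  have dist: "w (ps ! i) \<noteq> w (ps ! j)" if "i < j" "j < length ps" for i j
    using injP psP mono[OF that] that by (metis inj_onD less_irrefl less_trans)
  have step: "(w (ps ! i), w (ps ! Suc i)) \<in> digraph_power A k" if i: "Suc i < length ps" for i
  proof (rule relpow_digraph_power)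
    show "(w (ps ! i), w (ps ! Suc i)) \<in> A ^^ (ps ! Suc i - ps ! i)"
      by (rule relpow_walk_segment[of m w A]) (use walk mono[of i "Suc i"] i ltm[OF psP[OF i]] in auto)
  qed (use gap[OF i] L dist i in auto)
  let ?a = "ps ! 0" and ?b = "ps ! (length ps - 1)"
  have ab: "?a < m" "?b < m" "?a < ?b" 
    using ltm[OF psP, of 0] ltm[OF psP, of "length ps - 1"] mono[of 0 "length ps - 1"] len ne by simp_all
  \<comment> \<open>The first chosen position lies in window 0 and the last one no earlier than
    window \<open>?q - 1\<close>. The incomplete rest after the full windows, shorter than L,
    accounts for the third L.\<close>
  have wrap: "m - ?b + ?a \<le> 3 * L"
  proof (cases "?q = 0")
    case True
    then have "m < L" using L(1) by (simp add: div_eq_0_iff)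
    then show ?thesis using ab by linarith
  next
    case False
    obtain j where j: "j < length ps" "ps ! j < L" using hit[of 0] False by auto
    have "?a \<le> ps ! j" using mono[of 0 j] j by (cases "j = 0") auto
    obtain l where l: "l < length ps" "(?q - 1) * L \<le> ps ! l" using hit[of "?q - 1"] False by auto
    have "ps ! l \<le> ?b" 
    proof (cases "l = length ps - 1")
      case False
      then have "l < length ps - 1" using l(1) by linarith
      then show ?thesis using mono[of l "length ps - 1"] ne by simp
    qed simp
    have "m < ?q * L + L" using dividend_less_div_times[OF L(1), of m] by (simp add: add.commute)
    also have "\<dots> = (?q - 1) * L + 2 * L" using False by (cases ?q) auto
    finally show ?thesis using \<open>?a \<le> ps ! j\<close> \<open>ps ! l \<le> ?b\<close> j l by linarith
  qed
  have last: "(w ?b, w ?a) \<in> digraph_power A k"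
  proof (rule relpow_digraph_power)
    have "(w ?b, w m) \<in> A ^^ (m - ?b)" "(w 0, w ?a) \<in> A ^^ (?a - 0)"
      by (rule relpow_walk_segment[of m w A]; use walk ab in simp)+
    then show "(w ?b, w ?a) \<in> A ^^ (m - ?b + ?a)" using closed by (auto simp: relpow_add)
  qed (use wrap L dist[of 0 "length ps - 1", symmetric] len in auto)
  have "distinct (map w ps)" using ps injP by (simp add: distinct_map)
  moreover have "set (map w ps) = V" using ps wP by simp
  ultimately show ?thesis unfolding hamiltonian_def
    using len step last ne by (intro exI[of _ "map w ps"]) (auto simp: last_map hd_map last_conv_nth hd_conv_nth)
qed

theorem theorem1p1:
  fixes V :: "'a set" and A :: "('a \<times> 'a) set" and n k :: nat
  assumes "simple_digraph V A"
    and "connected_digraph V A"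
    and "eulerian V A"
    and "n = card V"
    and "n \<ge> 2"
    and "k = nat \<lceil>(1/2) * sqrt (real n) * (log 2 (real n))\<^sup>2\<rceil>"
  shows "hamiltonian V (digraph_power A k)"
proof -
  have V: "finite V" "A \<subseteq> V \<times> V" using assms(1) by (auto simp: simple_digraph_def)
  have finA: "finite A" using V finite_subset by blast
  obtain B where B: "B \<subseteq> A" "connected_digraph V B" "balanced B"
    and min: "\<And>C. C \<subset> B \<Longrightarrow> balanced C \<Longrightarrow> \<not> connected_digraph V C"
    using minimal_balanced_connected[OF finA assms(2) eulerian_balanced[OF assms(3)]] by metis
  have BV: "B \<subseteq> V \<times> V" using B V by blast
  obtain w m where tour: "bij_betw (\<lambda>i. (w i, w (Suc i))) {..<m} B" and closed: "w m = w 0"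
    using euler_tour[OF V(1) BV B(2,3)] by blast
  have arc: "(w i, w (Suc i)) \<in> B" if "i < m" for i using tour that by (auto simp: bij_betw_def)
  \<comment> \<open>As n is at least 2, connectivity gives every vertex an arc, and balance then
    gives it an outgoing one, so the tour leaves it at an index below m.\<close>
  have cover: "w ` {..<m} = V"
  proof
    show "w ` {..<m} \<subseteq> V" using arc BV by blast
    show "V \<subseteq> w ` {..<m}"
    proof
      fix v assume v: "v \<in> V"
      obtain u where u: "u \<in> V" "u \<noteq> v"
        using assms(4,5) v by (metis card_le_Suc0_iff_eq V(1) not_less_eq_eq numeral_2_eq_2)
      then have "(v, u) \<in> (B \<union> B\<inverse>)\<^sup>*" using B(2) v by (auto simp: connected_digraph_def)
      then obtain x where "(v, x) \<in> B \<union> B\<inverse>" using u(2) by (metis converse_rtranclE)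
      then have "{e \<in> B. fst e = v} \<noteq> {} \<or> {e \<in> B. snd e = v} \<noteq> {}" by auto
      moreover have finB: "finite B" using finA B(1) finite_subset by blast
      moreover have "finite {e \<in> B. fst e = v}" "finite {e \<in> B. snd e = v}" using finB by simp_all
      ultimately have "{e \<in> B. fst e = v} \<noteq> {}"
        using balanced_degrees[OF finB B(3), of v] card_0_eq by metis
      then obtain y where "(v, y) \<in> B" by auto
      then show "v \<in> w ` {..<m}" using tour by (auto simp: bij_betw_def)
    qed
  qed
  \<comment> \<open>Here k is at least n - 1 and the closed tour makes all vertices mutually
    reachable, so the power is complete.\<close>
  have "hamiltonian V (digraph_power A k)" if "n < 2048"
  proof (rule hamiltonian_complete[OF V(1)])
    fix u v assume uv: "u \<in> V" "v \<in> V" "u \<noteq> v"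
    have "(u, v) \<in> B\<^sup>*"
    proof -
      obtain i j where ij: "i < m" "u = w i" "j < m" "v = w j" using uv cover by blast
      have "(w i, w m) \<in> B ^^ (m - i)" "(w 0, w j) \<in> B ^^ (j - 0)"
        by (rule relpow_walk_segment[of m w B]; use arc ij in simp)+
      then show ?thesis using closed ij by (metis relpow_imp_rtrancl rtrancl_trans)
    qed
    then have "(u, v) \<in> A\<^sup>*" using rtrancl_mono[OF B(1)] by blast
    moreover have "card V - 1 \<le> k"
      using small_order_exponent[OF assms(5) that] assms(4,6) by simp
    ultimately show "(u, v) \<in> digraph_power A k"
      using uv by (intro reachable_digraph_power[OF V])
  qed (use assms in simp)
  moreover have "hamiltonian V (digraph_power A k)" if "\<not> n < 2048"
  proof -
    have "2048 \<le> n" using that by simp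
    then obtain s where s: "0 < s" "card V \<le> s\<^sup>2" and k: "3 * (9 * s + 2) \<le> k"
      unfolding assms(4)[symmetric] assms(6) by (rule large_order_exponent)
    define L where "L = 9 * s + 2"
    have "\<exists>f. inj_on f {..<m div L} \<and> (\<forall>i\<in>{..<m div L}. f i \<in> w ` {i * L..<i * L + L})"
      by (rule hall_marriage)
         (use tour_window_union[OF V(1) BV B(2,3) min tour s L_def] in auto)
    then obtain f where f: "inj_on f {..<m div L}" "\<And>i. i < m div L \<Longrightarrow> f i \<in> w ` {i * L..<i * L + L}"
      by blast
    show ?thesis
      by (rule hamiltonian_of_window_representatives[of V w m A L k f])
         (use V assms(4,5) cover arc B(1) closed k f in \<open>auto simp: L_def\<close>)
  qed
  ultimately show ?thesis by blast
qed

end
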